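(* Let $n \geq 1$ and $s_1, s_2, \ldots, s_n \geq 2$ be integers. Then (i) the (strong) independent set sequence of the linear hyperpath $P(s_1, \ldots, s_n)$ is real-rooted, and (ii) the (strong) independent set sequence of the linear hyperstar $S(s_1, \ldots, s_n)$ is log-concave.
   Context: A hypergraph is a pair $(V,E)$ with $E$ a set of subsets of $V$ (edges). A (strong) independent set in a hypergraph is a set of vertices containing at most one vertex from each edge. The independent set sequence of a hypergraph $H$ is $(i_k(H))_{k\ge 0}$, where $i_k(H)$ is the number of independent sets of size $k$. The linear hyperpath $P(s_1,\ldots,s_n)$ is the hypergraph with $n$ edges $e_1,\ldots,e_n$, $|e_i|=s_i$, where $e_i$ and $e_{i+1}$ share exactly one vertex for each $i<n$ and no other pairs of edges share a vertex. The linear hyperstar $S(s_1,\ldots,s_n)$ is the hypergraph with $n$ edges $e_1,\ldots,e_n$, $|e_i|=s_i$, such that there is a single vertex (the center) common to all edges and any two edges intersect only in the center. A finite sequence $(a_k)_{k=0}^m$ is real-rooted if the polynomial $\sum_k a_k x^k$ has only real roots, and log-concave if $a_k^2 \ge a_{k-1}a_{k+1}$ for all $1\le k\le m-1$. *)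

theory Defs
  imports Complex_Main "HOL-Computational_Algebra.Polynomial"
begin

type_synonym 'a hypergraph = "'a set \<times> 'a set set"

abbreviation verts :: "'a hypergraph \<Rightarrow> 'a set" where
  "verts H \<equiv> fst H"

abbreviation edges :: "'a hypergraph \<Rightarrow> 'a set set" where
  "edges H \<equiv> snd H"

definition strong_independent :: "'a hypergraph \<Rightarrow> 'a set \<Rightarrow> bool" where
  "strong_independent H S \<longleftrightarrow>
     S \<subseteq> verts H \<and> (\<forall>e\<in>edges H. \<forall>x\<in>S \<inter> e. \<forall>y\<in>S \<inter> e. x = y)"

definition indep_count :: "'a hypergraph \<Rightarrow> nat \<Rightarrow> nat" where
  "indep_count H k = card {S. strong_independent H S \<and> finite S \<and> card S = k}"

text \<open>
  The edges are indexed \<open>e 1, \<dots>, e n\<close>.  The vertex set is the union of the edges,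
  i.e. there are no isolated vertices; this makes the hypergraph unique up to isomorphism.
\<close>

definition linear_hyperpath :: "nat \<Rightarrow> (nat \<Rightarrow> nat) \<Rightarrow> 'a hypergraph \<Rightarrow> bool" where
  "linear_hyperpath n s H \<longleftrightarrow>
     (\<exists>e. inj_on e {1..n} \<and> edges H = e ` {1..n} \<and> verts H = (\<Union>i\<in>{1..n}. e i) \<and>
          (\<forall>i\<in>{1..n}. finite (e i) \<and> card (e i) = s i) \<and>
          (\<forall>i\<in>{1..<n}. card (e i \<inter> e (i + 1)) = 1) \<and>
          (\<forall>i\<in>{1..n}. \<forall>j\<in>{1..n}. i + 1 < j \<longrightarrow> e i \<inter> e j = {}))"

definition linear_hyperstar :: "nat \<Rightarrow> (nat \<Rightarrow> nat) \<Rightarrow> 'a hypergraph \<Rightarrow> bool" where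
  "linear_hyperstar n s H \<longleftrightarrow>
     (\<exists>e c. inj_on e {1..n} \<and> edges H = e ` {1..n} \<and> verts H = (\<Union>i\<in>{1..n}. e i) \<and>
          (\<forall>i\<in>{1..n}. finite (e i) \<and> card (e i) = s i) \<and>
          (\<forall>i\<in>{1..n}. c \<in> e i) \<and>
          (\<forall>i\<in>{1..n}. \<forall>j\<in>{1..n}. i \<noteq> j \<longrightarrow> e i \<inter> e j = {c}))"

text \<open>The following two notions concern the finite sequence \<open>a 0, \<dots>, a m\<close>.\<close>

definition real_rooted_seq :: "nat \<Rightarrow> (nat \<Rightarrow> real) \<Rightarrow> bool" where
  "real_rooted_seq m a \<longleftrightarrow>
     (\<forall>z::complex. poly (\<Sum>k\<le>m. monom (complex_of_real (a k)) k) z = 0 \<longrightarrow> z \<in> \<real>)"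

definition log_concave_seq :: "nat \<Rightarrow> (nat \<Rightarrow> real) \<Rightarrow> bool" where
  "log_concave_seq m a \<longleftrightarrow> (\<forall>k. 1 \<le> k \<and> k \<le> m - 1 \<longrightarrow> (a k)\<^sup>2 \<ge> a (k - 1) * a (k + 1))"

text \<open>
  Independent sets have at most \<open>card (verts H)\<close> elements, so cutting the independent set
  sequence off at that index drops only zeros.
\<close>

lemma indep_count_eq_0:
  assumes "finite (verts H)" and "k > card (verts H)"
  shows "indep_count H k = 0"
proof -
  have "{S. strong_independent H S \<and> finite S \<and> card S = k} = {}"
    using assms(2) card_mono[OF assms(1)] unfolding strong_independent_def
    by (auto dest: leD)
  then show ?thesis unfolding indep_count_def by (simp only: card.empty)
qed

lemma linear_hyperpath_exists:
  assumes "\<forall>i\<in>{1..n}. s i \<ge> 2"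
  shows "\<exists>H :: (nat \<times> nat) hypergraph. linear_hyperpath n s H"
proof -
  define e where "e i = insert (i + 1, 0) ({i} \<times> {..<s i - 1})" for i :: nat
  have card_e: "finite (e i) \<and> card (e i) = s i" if "i \<in> {1..n}" for i
    using bspec[OF assms that] by (simp add: e_def)
  have meet: "e i \<inter> e (i + 1) = {(i + 1, 0)}" if "i \<in> {1..<n}" for i
  proof -
    have "i + 1 \<in> {1..n}" using that by simp
    then have "s (i + 1) \<ge> 2" by (rule bspec[OF assms])
    then show ?thesis by (auto simp: e_def)
  qed
  have disj: "e i \<inter> e j = {}" if "i + 1 < j" for i j
    using that by (auto simp: e_def)
  have "inj_on e {1..n}"
  proof (rule inj_onI)
    fix i j assume ij: "i \<in> {1..n}" "j \<in> {1..n}" "e i = e j"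
    have "(i, 0) \<in> e i" "(j, 0) \<in> e j"
      using bspec[OF assms ij(1)] bspec[OF assms ij(2)] by (auto simp: e_def)
    then have "(i, 0) \<in> e j" "(j, 0) \<in> e i" using ij(3) by auto
    then show "i = j" by (auto simp: e_def)
  qed
  then have "linear_hyperpath n s (\<Union>i\<in>{1..n}. e i, e ` {1..n})"
    unfolding linear_hyperpath_def using card_e meet disj
    by (intro exI[of _ e] conjI ballI impI) simp_all
  then show ?thesis ..
qed

lemma linear_hyperstar_exists:
  assumes "\<forall>i\<in>{1..n}. s i \<ge> 2"
  shows "\<exists>H :: (nat \<times> nat) hypergraph. linear_hyperstar n s H"
proof -
  define e where "e i = insert (0, 0) ({i} \<times> {1..<s i})" for i :: nat
  have card_e: "finite (e i) \<and> card (e i) = s i" if "i \<in> {1..n}" for i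
    using bspec[OF assms that] by (simp add: e_def)
  have meet: "e i \<inter> e j = {(0, 0)}" if "i \<noteq> j" for i j
    using that by (auto simp: e_def)
  have "inj_on e {1..n}"
  proof (rule inj_onI)
    fix i j assume ij: "i \<in> {1..n}" "j \<in> {1..n}" "e i = e j"
    have "(i, 1) \<in> e i" using bspec[OF assms ij(1)] by (auto simp: e_def)
    then have "(i, 1) \<in> e j" using ij(3) by simp
    then show "i = j" by (auto simp: e_def)
  qed
  then have "linear_hyperstar n s (\<Union>i\<in>{1..n}. e i, e ` {1..n})"
    unfolding linear_hyperstar_def using card_e meet
    by (intro exI[of _ e] exI[of _ "(0, 0)"] conjI ballI impI) (simp_all, simp add: e_def)
  then show ?thesis ..
qed

end

(*
  Both parts rest on one recurrence for the independence polynomial: if the vertices of K lie in a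
  common edge and all have the same neighbourhood N in U, then
  I(U + K) = I(U) + |K| x I(U - N).

  Path: let F j and G j be the independence polynomials of the first j edges, without and with the
  vertices of the edge j+1 removed. Then, for some natural number a,
  G (j+1) = F j + a x G j and F (j+1) = G (j+1) + x G j, so w = F/G satisfies
  w (j+1) = 1 + z / (w j + a z). For non-real z the convex cone spanned by 1 and z is stable
  under w \<mapsto> z / w and does not contain -1, hence by induction w j - 1 stays in the cone and
  no F j vanishes at z.

  Star: the independence polynomial is x + prod (1 + (s i - 1) x). Log-concavity of the product is
  standard; the additional x only matters at k = 2, where s i - 1 \<ge> 1 leaves enough room.
*)
theory Submission
  imports Defs
begin

section \<open>Independence polynomials\<close>

text \<open>The ground set \<open>U\<close> is separate from \<open>H\<close>, so that vertices can
  be deleted while independence is still tested against the same edges.\<close>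

definition indep_poly :: "'a hypergraph \<Rightarrow> 'a set \<Rightarrow> 'b::comm_semiring_1 poly" where
  "indep_poly H U = (\<Sum>S | S \<subseteq> U \<and> strong_independent H S. monom 1 (card S))"

lemma strong_independent_insert:
  "strong_independent H (insert v S) \<longleftrightarrow>
     v \<in> verts H \<and> strong_independent H S \<and> (\<forall>e\<in>edges H. \<forall>y\<in>S. v \<in> e \<longrightarrow> y \<in> e \<longrightarrow> y = v)"
  unfolding strong_independent_def by auto

lemma indep_poly_empty [simp]: "indep_poly H {} = 1"
proof -
  have "{S. S \<subseteq> {} \<and> strong_independent H S} = {{}}"
    by (auto simp: strong_independent_def)
  then show ?thesis by (simp only: indep_poly_def) (simp add: one_pCons monom_0)
qed

lemma coeff_indep_poly:
  assumes "finite (verts H)"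
  shows "coeff (indep_poly H (verts H) :: 'b::comm_semiring_1 poly) k = of_nat (indep_count H k)"
proof -
  let ?A = "{S. S \<subseteq> verts H \<and> strong_independent H S}"
  have fin: "finite ?A" using assms by simp
  have "{S. strong_independent H S \<and> finite S \<and> card S = k} = ?A \<inter> {S. card S = k}"
    using assms by (auto simp: strong_independent_def intro: finite_subset)
  then have "(of_nat (indep_count H k) :: 'b) = of_nat (card (?A \<inter> {S. card S = k}))"
    unfolding indep_count_def by (simp only:)
  also have "\<dots> = (\<Sum>S\<in>?A. if card S = k then 1 else 0)"
    using fin by (subst sum.inter_filter[symmetric]) (auto simp: Int_def)
  finally show ?thesis
    by (simp add: indep_poly_def coeff_sum)
qed

text \<open>An independent set meets the clique \<open>K\<close> in at most one vertex
  \<open>v\<close>. If it contains such a \<open>v\<close>, the rest is an independent subset of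
  \<open>U\<close> avoiding the neighbours of \<open>v\<close>, and these are cut out by the same
  \<open>N\<close> for every choice of \<open>v\<close>.\<close>

lemma indep_poly_Un:
  assumes fin: "finite U" "finite K" and verts: "U \<union> K \<subseteq> verts H" and disj: "U \<inter> K = {}"
    and clique: "\<And>v w. v \<in> K \<Longrightarrow> w \<in> K \<Longrightarrow> \<exists>e\<in>edges H. v \<in> e \<and> w \<in> e"
    and nbrs: "\<And>v u. v \<in> K \<Longrightarrow> u \<in> U \<Longrightarrow> (\<exists>e\<in>edges H. v \<in> e \<and> u \<in> e) \<longleftrightarrow> u \<in> N"
  shows "indep_poly H (U \<union> K) =
           indep_poly H U + monom (of_nat (card K)) 1 * indep_poly H (U - N)"
proof -
  let ?I = "\<lambda>U. {S. S \<subseteq> U \<and> strong_independent H S}"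
  let ?f = "\<lambda>(v, S). insert v S"
  have split: "?I (U \<union> K) = ?I U \<union> ?f ` (K \<times> ?I (U - N))"
  proof (intro equalityI subsetI)
    fix S assume S: "S \<in> ?I (U \<union> K)"
    show "S \<in> ?I U \<union> ?f ` (K \<times> ?I (U - N))"
    proof (cases "S \<subseteq> U")
      case True
      then show ?thesis using S by simp
    next
      case False
      then obtain v where v: "v \<in> S" "v \<in> K" using S by blast
      define T where "T = S - {v}"
      have ST: "S = insert v T" "v \<notin> T" using v by (auto simp: T_def)
      have T: "strong_independent H T"
        and ind: "\<And>e y. e \<in> edges H \<Longrightarrow> y \<in> T \<Longrightarrow> v \<in> e \<Longrightarrow> y \<in> e \<Longrightarrow> y = v"
        using S unfolding ST(1) by (auto simp: strong_independent_insert)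
      have "T \<subseteq> U - N"
      proof
        fix y assume y: "y \<in> T"
        have no_edge: "\<not> (\<exists>e\<in>edges H. v \<in> e \<and> y \<in> e)" using ind y ST(2) by blast
        then have "y \<notin> K" using clique[OF v(2), of y] by blast
        then have "y \<in> U" using S y by (auto simp: ST(1))
        then show "y \<in> U - N" using nbrs[OF v(2)] no_edge by blast
      qed
      then show ?thesis using T v by (auto simp: ST(1))
    qed
  next
    fix S assume "S \<in> ?I U \<union> ?f ` (K \<times> ?I (U - N))"
    then show "S \<in> ?I (U \<union> K)"
    proof
      assume "S \<in> ?f ` (K \<times> ?I (U - N))"
      then obtain v T where vT: "v \<in> K" "T \<subseteq> U - N" "strong_independent H T" "S = insert v T"
        by auto
      have "\<not> (\<exists>e\<in>edges H. v \<in> e \<and> y \<in> e)" if "y \<in> T" for y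
        using nbrs[OF vT(1), of y] vT(2) that by blast
      then have "strong_independent H S"
        unfolding vT(4) strong_independent_insert using vT verts by blast
      then show ?thesis using vT by auto
    qed auto
  qed
  have fin': "finite (?I U)" "finite (?I (U - N))" using fin by auto
  \<comment> \<open>The vertex \<open>v\<close> is recovered from \<open>insert v S\<close> as its
    only element outside \<open>U\<close>.\<close>
  have inj: "inj_on ?f (K \<times> ?I (U - N))"
  proof (rule inj_onI, clarsimp)
    fix v S w T
    assume vw: "v \<in> K" "w \<in> K" and ST: "S \<subseteq> U - N" "T \<subseteq> U - N" and eq: "insert v S = insert w T"
    have "v \<notin> S" "v \<notin> T" "w \<notin> S" "w \<notin> T" using vw ST disj by auto
    then show "v = w \<and> S = T" using eq by (metis insert_ident insert_iff)
  qed
  have card: "card (insert v S) = Suc (card S)" if "v \<in> K" "S \<in> ?I (U - N)" for v S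
  proof -
    have "v \<notin> S" "finite S" using that disj fin by (auto intro: finite_subset)
    then show ?thesis by simp
  qed
  have "indep_poly H (U \<union> K) = (indep_poly H U :: 'b poly) +
          (\<Sum>S\<in>?f ` (K \<times> ?I (U - N)). monom 1 (card S))"
    unfolding indep_poly_def split using fin' fin disj by (intro sum.union_disjoint) auto
  also have "(\<Sum>S\<in>?f ` (K \<times> ?I (U - N)). monom (1::'b) (card S)) =
      (\<Sum>p\<in>K \<times> ?I (U - N). monom 1 1 * monom 1 (card (snd p)))"
    unfolding sum.reindex[OF inj] o_def
    by (intro sum.cong refl) (clarsimp simp: card mult_monom)
  also have "\<dots> = (\<Sum>v\<in>K. \<Sum>S\<in>?I (U - N). monom 1 1 * monom 1 (card S))"
    by (subst sum.cartesian_product) (simp add: case_prod_beta)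
  also have "\<dots> = of_nat (card K) * (monom 1 1 * indep_poly H (U - N))"
    by (simp add: indep_poly_def sum_distrib_left)
  also have "\<dots> = monom (of_nat (card K)) 1 * indep_poly H (U - N)"
    by (simp add: of_nat_poly monom_altdef mult.assoc[symmetric])
  finally show ?thesis .
qed

section \<open>Hyperpaths\<close>

text \<open>
  For non-real \<open>z\<close> this is \<open>{\<alpha> + \<beta> z | \<alpha>, \<beta> \<ge> 0}\<close>; the factor \<open>Im z\<close> treats both half-planes at once.
\<close>

definition cone :: "complex \<Rightarrow> complex set" where
  "cone z = {w. Im z * Im w \<ge> 0 \<and> Im z * Im (z * cnj w) \<ge> 0}"

lemma cone_add: "v \<in> cone z \<Longrightarrow> w \<in> cone z \<Longrightarrow> v + w \<in> cone z"
  by (simp add: cone_def algebra_simps)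

lemma one_in_cone: "1 \<in> cone z" and self_in_cone: "z \<in> cone z"
  by (simp_all add: cone_def)

lemma cone_scale:
  assumes "w \<in> cone z" "r \<ge> 0"
  shows "of_real r * w \<in> cone z"
proof -
  have eq: "Im z * Im (of_real r * w) = r * (Im z * Im w)"
    "Im z * Im (z * cnj (of_real r * w)) = r * (Im z * Im (z * cnj w))"
    by (simp_all add: algebra_simps)
  show ?thesis unfolding cone_def mem_Collect_eq eq
    using assms unfolding cone_def by (blast intro: mult_nonneg_nonneg)
qed

text \<open>Up to a nonnegative real factor \<open>z / w\<close> is \<open>z * cnj w\<close>, and
  passing from \<open>w\<close> to \<open>z * cnj w\<close> swaps the two inequalities of the cone,
  up to the factor \<open>|z|^2\<close>. The case \<open>w = 0\<close> is covered, since then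
  \<open>z / w = 0\<close>.\<close>

lemma cone_divide:
  assumes "w \<in> cone z"
  shows "z / w \<in> cone z"
proof -
  have eq: "z / w = of_real (1 / (cmod w)\<^sup>2) * (z * cnj w)"
    by (subst complex_div_cnj) simp
  have eq': "Im z * Im (z * cnj (z * cnj w)) = (cmod z)\<^sup>2 * (Im z * Im w)"
    unfolding cmod_power2 by (simp add: power2_eq_square algebra_simps)
  have "z * cnj w \<in> cone z" unfolding cone_def mem_Collect_eq eq'
    using assms unfolding cone_def by (blast intro: mult_nonneg_nonneg zero_le_power2)
  then show ?thesis unfolding eq by (rule cone_scale) simp
qed

text \<open>For non-real \<open>z\<close> the point -1 violates the second cone condition, which
  would read \<open>-(Im z)^2 >= 0\<close>.\<close>

lemma cone_plus_one_nonzero: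
  assumes "z \<notin> \<real>" "w - 1 \<in> cone z"
  shows "w \<noteq> 0"
proof
  assume "w = 0"
  then have "Im z * Im z \<le> 0" using assms(2) by (simp add: cone_def)
  then show False using assms(1) not_real_square_gt_zero[of "Im z"]
    by (simp only: complex_is_Real_iff) linarith
qed

lemma hyperpath_indep_poly_nonzero:
  fixes z :: complex
  assumes path: "linear_hyperpath n s H" and n: "n \<ge> 1" and z: "z \<notin> \<real>"
  shows "poly (indep_poly H (verts H)) z \<noteq> 0"
proof -
  obtain e where edges: "edges H = e ` {1..n}" and verts: "verts H = (\<Union>i\<in>{1..n}. e i)"
    and e: "\<forall>i\<in>{1..n}. finite (e i) \<and> card (e i) = s i"
      "\<forall>i\<in>{1..<n}. card (e i \<inter> e (i + 1)) = 1"
      "\<forall>i\<in>{1..n}. \<forall>j\<in>{1..n}. i + 1 < j \<longrightarrow> e i \<inter> e j = {}"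
    using path unfolding linear_hyperpath_def by blast
  have fin_e: "finite (e i)" if "i \<in> {1..n}" for i using e(1) that by blast
  have meet: "card (e i \<inter> e (i + 1)) = 1" if "i \<in> {1..<n}" for i using e(2) that by blast
  have far: "e i \<inter> e j = {}" if "i \<in> {1..n}" "j \<in> {1..n}" "i + 1 < j" for i j
    using e(3) that by blast
  define V where "V j = (\<Union>i\<in>{1..j}. e i)" for j
  define F where "F j = poly (indep_poly H (V j)) z" for j
  define G where "G j = poly (indep_poly H (V j - e (j + 1))) z" for j
  have V_Suc: "V (Suc j) = V j \<union> e (Suc j)" for j
    unfolding V_def by (auto simp: atLeastAtMostSuc_conv)
  have fin_V: "finite (V j)" if "j \<le> n" for j using that fin_e unfolding V_def by auto
  have V_far: "V j \<inter> e i = {}" if "j + 1 < i" "i \<le> n" for i j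
  proof -
    have "e l \<inter> e i = {}" if "l \<in> {1..j}" for l
      using that \<open>j + 1 < i\<close> \<open>i \<le> n\<close> by (intro far) auto
    then show ?thesis unfolding V_def by blast
  qed
  \<comment> \<open>Used with two choices of \<open>K\<close>: all new vertices of the next edge
    give \<open>F (Suc j)\<close>; those outside the edge after it give
    \<open>G (Suc j)\<close>.\<close>
  have step: "poly (indep_poly H (V j \<union> K)) z = F j + of_nat (card K) * z * G j"
    if j: "j < n" and K: "K \<subseteq> e (j + 1) - V j" for j K
  proof -
    have j1: "e (j + 1) \<in> edges H" using j by (auto simp: edges)
    have "indep_poly H (V j \<union> K) = (indep_poly H (V j) :: complex poly) +
        monom (of_nat (card K)) 1 * indep_poly H (V j - e (j + 1))"
    proof (rule indep_poly_Un)
      show "finite (V j)" using j by (intro fin_V) simp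
      have "finite (e (j + 1))" using j by (intro fin_e) simp
      then show "finite K" using K by (auto intro: finite_subset)
      have "e (j + 1) \<subseteq> verts H" unfolding verts using j by (intro UN_upper) simp
      moreover have "V j \<subseteq> verts H" unfolding verts V_def using j by (intro UN_mono) auto
      ultimately show "V j \<union> K \<subseteq> verts H" using K by auto
      show "V j \<inter> K = {}" using K by auto
      show "\<exists>e\<in>edges H. v \<in> e \<and> w \<in> e" if "v \<in> K" "w \<in> K" for v w
        using that j1 K by blast
      show "(\<exists>e\<in>edges H. v \<in> e \<and> u \<in> e) \<longleftrightarrow> u \<in> e (j + 1)" if v: "v \<in> K" and u: "u \<in> V j" for v u
      proof
        assume "\<exists>e\<in>edges H. v \<in> e \<and> u \<in> e"
        then obtain i where i: "i \<in> {1..n}" "v \<in> e i" "u \<in> e i" by (auto simp: edges)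
        \<comment> \<open>Earlier edges miss \<open>v\<close>, because \<open>K\<close> avoids
          \<open>V j\<close>; later edges miss \<open>u\<close>, because they are disjoint from
          \<open>V j\<close>.\<close>
        have "\<not> i \<le> j" using i v K by (auto simp: V_def)
        moreover have "\<not> j + 1 < i" using V_far[of j i] i u by auto
        ultimately have "i = j + 1" by simp
        then show "u \<in> e (j + 1)" using i by simp
      next
        assume "u \<in> e (j + 1)"
        then show "\<exists>e\<in>edges H. v \<in> e \<and> u \<in> e" using v K j1 by blast
      qed
    qed
    then show ?thesis by (simp add: F_def G_def poly_monom)
  qed
  have F_Suc: "F (Suc j) = F j + of_nat (card (e (j + 1) - V j)) * z * G j" if "j < n" for j
    using step[OF that, of "e (j + 1) - V j"] by (simp add: F_def V_Suc)
  \<comment> \<open>The bound \<open>j < n\<close> keeps \<open>e (j + 1)\<close>, which enters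
    \<open>G j\<close>, among the edges of the path.\<close>
  have inv: "G j \<noteq> 0 \<and> F j / G j - 1 \<in> cone z" if "j < n" for j
    using that
  proof (induction j)
    case 0
    then show ?case by (simp add: F_def G_def V_def cone_def)
  next
    case (Suc j)
    define K where "K = e (j + 1) - V j - e (j + 2)"
    \<comment> \<open>This will be the quotient \<open>G (Suc j) / G j\<close>.\<close>
    define u where "u = F j / G j + of_nat (card K) * z"
    from Suc have G0: "G j \<noteq> 0" and w: "F j / G j - 1 \<in> cone z" by auto
    have "V j \<inter> e (j + 2) = {}" using Suc.prems by (intro V_far) auto
    then have "V (Suc j) - e (Suc j + 1) = V j \<union> K" by (auto simp: V_Suc K_def)
    moreover have "poly (indep_poly H (V j \<union> K)) z = F j + of_nat (card K) * z * G j"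
      using Suc.prems by (intro step) (auto simp: K_def)
    ultimately have G_Suc: "G (Suc j) = F j + of_nat (card K) * z * G j"
      unfolding G_def by simp
    then have G_u: "G (Suc j) = u * G j" using G0 by (simp add: u_def field_simps)
    have "card (e (j + 1) \<inter> e (j + 2)) = 1" using meet[of "j + 1"] Suc.prems by simp
    then obtain v where v: "e (j + 1) \<inter> e (j + 2) = {v}" by (auto simp: card_1_singleton_iff)
    \<comment> \<open>The vertex shared with the next edge is the only new one counted in
      \<open>F (Suc j)\<close> but not in \<open>G (Suc j)\<close>; the two therefore differ by
      exactly \<open>z * G j\<close>.\<close>
    have "e (j + 1) - V j = insert v K" "v \<notin> K"
      using v \<open>V j \<inter> e (j + 2) = {}\<close> by (auto simp: K_def)
    moreover have "finite K" using Suc.prems fin_e by (simp add: K_def)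
    ultimately have "card (e (j + 1) - V j) = Suc (card K)" by simp
    then have F_G: "F (Suc j) = G (Suc j) + z * G j"
      using F_Suc[of j] Suc.prems by (simp add: G_Suc algebra_simps)
    have "of_real (real (card K)) * z \<in> cone z" by (intro cone_scale self_in_cone) simp
    from cone_add[OF w this] have u1: "u - 1 \<in> cone z" by (simp add: u_def algebra_simps)
    have "u \<noteq> 0" using cone_plus_one_nonzero[OF z u1] .
    have "u \<in> cone z" using cone_add[OF u1 one_in_cone] by simp
    then have "z / u \<in> cone z" by (rule cone_divide)
    moreover have "F (Suc j) / G (Suc j) - 1 = z / u"
      using G0 \<open>u \<noteq> 0\<close> by (simp add: F_G G_u add_divide_distrib)
    ultimately show ?case using G0 \<open>u \<noteq> 0\<close> by (simp add: G_u)
  qed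
  \<comment> \<open>No edge follows the last one, so \<open>F n\<close> is obtained directly from
    \<open>F j\<close> and \<open>G j\<close>: all new vertices are added at once and
    \<open>G n\<close> never appears.\<close>
  define j where "j = n - 1"
  have j: "j < n" "Suc j = n" using n by (auto simp: j_def)
  define u where "u = F j / G j + of_nat (card (e (j + 1) - V j)) * z"
  have "of_real (real (card (e (j + 1) - V j))) * z \<in> cone z"
    by (intro cone_scale self_in_cone) simp
  from cone_add[OF conjunct2[OF inv[OF j(1)]] this] have "u - 1 \<in> cone z"
    by (simp add: u_def algebra_simps)
  then have "u \<noteq> 0" using cone_plus_one_nonzero z by blast
  moreover have "F n = u * G j"
    using F_Suc[OF j(1)] inv[OF j(1)] by (simp add: u_def j(2) field_simps)
  ultimately have "F n \<noteq> 0" using inv[OF j(1)] by simp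
  then show ?thesis by (simp add: F_def V_def verts)
qed

section \<open>Hyperstars\<close>

text \<open>Without the center the edges are disjoint cliques with no adjacency between them, so
  each contributes a linear factor (\<open>N\<close> empty). The center is added last; it is
  adjacent to everything (\<open>N = U n\<close>) and contributes only \<open>x\<close>.\<close>

lemma hyperstar_indep_poly:
  assumes star: "linear_hyperstar n s H" and n: "n \<ge> 1"
  shows "indep_poly H (verts H) = (\<Prod>i=1..n. [:1, of_nat (s i - 1):]) + monom 1 1"
proof -
  obtain e c where edges: "edges H = e ` {1..n}" and verts: "verts H = (\<Union>i\<in>{1..n}. e i)"
    and e: "\<forall>i\<in>{1..n}. finite (e i) \<and> card (e i) = s i" "\<forall>i\<in>{1..n}. c \<in> e i"
      "\<forall>i\<in>{1..n}. \<forall>j\<in>{1..n}. i \<noteq> j \<longrightarrow> e i \<inter> e j = {c}"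
    using star unfolding linear_hyperstar_def by blast
  have fin_e: "finite (e i)" and card_e: "card (e i) = s i" if "i \<in> {1..n}" for i
    using e(1) that by blast+
  have c: "c \<in> e i" if "i \<in> {1..n}" for i using e(2) that by blast
  have meet: "e i \<inter> e j = {c}" if "i \<in> {1..n}" "j \<in> {1..n}" "i \<noteq> j" for i j
    using e(3) that by blast
  define U where "U j = (\<Union>i\<in>{1..j}. e i) - {c}" for j
  have fin_U: "finite (U j)" if "j \<le> n" for j using that fin_e unfolding U_def by auto
  have U_verts: "U j \<subseteq> verts H" if "j \<le> n" for j using that by (auto simp: U_def verts)
  have prod: "indep_poly H (U j) = (\<Prod>i=1..j. [:1, of_nat (s i - 1):] :: 'b poly)" if "j \<le> n" for j
    using that
  proof (induction j)
    case 0
    then show ?case by (simp add: U_def)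
  next
    case (Suc j)
    define K where "K = e (Suc j) - {c}"
    have j1: "Suc j \<in> {1..n}" using Suc.prems by simp
    have disj: "U j \<inter> e (Suc j) = {}"
    proof -
      have "e i \<inter> e (Suc j) = {c}" if "i \<in> {1..j}" for i
        using that j1 by (intro meet) auto
      then show ?thesis unfolding U_def by blast
    qed
    have "indep_poly H (U j \<union> K) = (indep_poly H (U j) :: 'b poly) +
        monom (of_nat (card K)) 1 * indep_poly H (U j - {})"
    proof (rule indep_poly_Un)
      show "finite (U j)" using Suc.prems by (intro fin_U) simp
      show "finite K" using fin_e[OF j1] by (simp add: K_def)
      have "U j \<subseteq> verts H" using Suc.prems by (intro U_verts) simp
      then show "U j \<union> K \<subseteq> verts H" using j1 by (auto simp: K_def verts)
      show "U j \<inter> K = {}" using disj by (auto simp: K_def)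
      show "\<exists>e\<in>edges H. v \<in> e \<and> w \<in> e" if "v \<in> K" "w \<in> K" for v w
        using that j1 by (auto simp: K_def edges)
      show "(\<exists>e\<in>edges H. v \<in> e \<and> u \<in> e) \<longleftrightarrow> u \<in> {}" if v: "v \<in> K" and u: "u \<in> U j" for v u
      proof -
        have False if i: "i \<in> {1..n}" "v \<in> e i" "u \<in> e i" for i
        proof (cases "i = Suc j")
          case True
          then show False using i u disj by auto
        next
          case False
          then show False using meet[OF i(1) j1] i v by (auto simp: K_def)
        qed
        then show ?thesis unfolding edges by blast
      qed
    qed
    moreover have "U (Suc j) = U j \<union> K"
      unfolding U_def K_def by (auto simp: atLeastAtMostSuc_conv)
    moreover have "card K = s (Suc j) - 1"
      using c[OF j1] card_e[OF j1] by (simp add: K_def)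
    ultimately show ?case using Suc
      by (simp add: monom_altdef algebra_simps)
  qed
  have "indep_poly H (U n \<union> {c}) = (indep_poly H (U n) :: 'b poly) +
      monom (of_nat (card {c})) 1 * indep_poly H (U n - U n)"
  proof (rule indep_poly_Un)
    have "c \<in> verts H" using c[of 1] n by (auto simp: verts)
    then show "U n \<union> {c} \<subseteq> verts H" using U_verts by auto
    show "U n \<inter> {c} = {}" by (auto simp: U_def)
    show "\<exists>e\<in>edges H. v \<in> e \<and> w \<in> e" if "v \<in> {c}" "w \<in> {c}" for v w
      using that c[of 1] n by (auto simp: edges)
    show "(\<exists>e\<in>edges H. v \<in> e \<and> u \<in> e) \<longleftrightarrow> u \<in> U n" if "v \<in> {c}" "u \<in> U n" for v u
      using that c by (auto simp: edges U_def)
  qed (simp_all add: fin_U)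
  moreover have "U n \<union> {c} = verts H" using c[of 1] n by (auto simp: U_def verts)
  ultimately show ?thesis using prod[of n] by simp
qed

section \<open>Log-concavity of products of linear factors\<close>

lemma coeff_linear_mult_Suc:
  fixes p :: "'a::comm_ring_1 poly"
  shows "coeff ([:1, a:] * p) (Suc k) = coeff p (Suc k) + a * coeff p k"
  by simp

lemma coeff_linear_mult_0:
  fixes p :: "'a::comm_ring_1 poly"
  shows "coeff ([:1, a:] * p) 0 = coeff p 0"
  by simp

text \<open>
  The exchange inequality for all \<open>i \<le> j\<close>, rather than only \<open>i = j\<close>, is what survives
  multiplication by a linear factor, because internal zeros are not excluded.
\<close>

lemma linear_mult_log_concave:
  fixes p :: "real poly"
  assumes nonneg: "\<And>k. coeff p k \<ge> 0" and a: "a \<ge> 0" and ij: "i \<le> j"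
    and lc: "\<And>i j. i \<le> j \<Longrightarrow> coeff p i * coeff p (j + 2) \<le> coeff p (i + 1) * coeff p (j + 1)"
  shows "coeff ([:1, a:] * p) i * coeff ([:1, a:] * p) (j + 2)
           \<le> coeff ([:1, a:] * p) (i + 1) * coeff ([:1, a:] * p) (j + 1)"
proof -
  let ?c = "coeff p"
  have lc0: "?c i * ?c (j + 2) \<le> ?c (i + 1) * ?c (j + 1)" by (rule lc[OF ij])
  show ?thesis
  proof (cases i)
    case 0
    \<comment> \<open>After expansion, this is the surplus of the right side beyond
      \<open>lc0\<close>; the terms \<open>a * c 0 * c (j + 1)\<close> cancel.\<close>
    have "0 \<le> a * (?c 1 * ?c j) + a\<^sup>2 * (?c 0 * ?c j)"
      using a nonneg by simp
    with lc0 0 show ?thesis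
      by (simp add: coeff_linear_mult_0 numeral_2_eq_2 power2_eq_square algebra_simps del: mult_pCons_left)
  next
    case (Suc h)
    obtain l where l: "j = Suc l" using ij Suc by (cases j) auto
    \<comment> \<open>The claim is compared by powers of \<open>a\<close>: \<open>lc0\<close>
      settles the constant term, fact 2 the linear one after a common product cancels, and fact 1
      the quadratic one.\<close>
    have 1: "?c h * ?c (l + 2) \<le> ?c (h + 1) * ?c (l + 1)" using ij Suc l by (intro lc) simp
    have 2: "?c h * ?c (l + 3) \<le> ?c (h + 2) * ?c (l + 1)"
    \<comment> \<open>In general two exchanges are chained, the second requiring
      \<open>h + 1 <= l\<close>; for \<open>h = l\<close> one exchange already gives the
      claim.\<close>
    proof (cases "h = l")
      case True
      then show ?thesis using lc[of h "Suc l"] by (simp add: eval_nat_numeral mult.commute)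
    next
      case False
      then have hl: "h + 1 \<le> l" using ij Suc l by simp
      have "?c h * ?c (l + 3) \<le> ?c (h + 1) * ?c (l + 2)"
        using lc[of h "l + 1"] hl by (simp add: eval_nat_numeral)
      also have "\<dots> \<le> ?c (h + 2) * ?c (l + 1)"
        using lc[of "h + 1" l] hl by (simp add: eval_nat_numeral)
      finally show ?thesis .
    qed
    have "0 \<le> a\<^sup>2 * (?c (h + 1) * ?c (l + 1) - ?c h * ?c (l + 2))"
      "0 \<le> a * (?c (h + 2) * ?c (l + 1) - ?c h * ?c (l + 3))"
      using 1 2 a by simp_all
    with lc0 show ?thesis
      by (simp add: coeff_linear_mult_Suc Suc l eval_nat_numeral algebra_simps del: mult_pCons_left)
  qed
qed

lemma prod_linear_log_concave:
  fixes a :: "nat \<Rightarrow> real"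
  assumes "\<And>i. i \<in> {1..n} \<Longrightarrow> a i \<ge> 0"
  shows "(\<forall>k. coeff (\<Prod>i=1..n. [:1, a i:]) k \<ge> 0) \<and>
    (\<forall>i j. i \<le> j \<longrightarrow> coeff (\<Prod>i=1..n. [:1, a i:]) i * coeff (\<Prod>i=1..n. [:1, a i:]) (j + 2)
        \<le> coeff (\<Prod>i=1..n. [:1, a i:]) (i + 1) * coeff (\<Prod>i=1..n. [:1, a i:]) (j + 1))"
  using assms
proof (induction n)
  case 0
  then show ?case by (auto simp: coeff_1)
next
  case (Suc n)
  define p where "p = (\<Prod>i=1..n. [:1, a i:])"
  have eq: "(\<Prod>i=1..Suc n. [:1, a i:]) = [:1, a (Suc n):] * p"
    by (simp add: p_def mult.commute)
  have a: "a (Suc n) \<ge> 0" using Suc.prems by simp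
  have "a i \<ge> 0" if "i \<in> {1..n}" for i using that by (intro Suc.prems) simp
  note IH = Suc.IH[folded p_def, OF this]
  have nonneg: "coeff p k \<ge> 0" for k using IH by blast
  have lc: "coeff p i * coeff p (j + 2) \<le> coeff p (i + 1) * coeff p (j + 1)" if "i \<le> j" for i j
    using IH that by blast
  have "coeff ([:1, a (Suc n):] * p) k \<ge> 0" for k
    using nonneg a by (cases k) simp_all
  then show ?case unfolding eq
    by (intro conjI allI impI linear_mult_log_concave[OF nonneg a _ lc])
qed

text \<open>
  With \<open>e k\<close> the elementary symmetric polynomials in numbers \<open>\<ge> 1\<close>, the last inequality
  \<open>e 2 ^ 2 \<ge> (e 1 + 1) * e 3\<close> is the one wanted; the others make the induction work.
\<close>

lemma prod_linear_coeff_ineqs: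
  fixes a :: "nat \<Rightarrow> real"
  assumes "\<And>i. i \<in> {1..n} \<Longrightarrow> a i \<ge> 1"
  defines "e \<equiv> \<lambda>k. coeff (\<Prod>i=1..n. [:1, a i:]) k"
  shows "e 0 = 1 \<and> e 1 \<ge> 0 \<and> e 2 \<le> (e 1)\<^sup>2 \<and> e 2 + e 3 \<le> e 1 * e 2 \<and> (e 1 + 1) * e 3 \<le> (e 2)\<^sup>2"
  using assms(1) unfolding e_def
proof (induction n)
  case 0
  then show ?case by (simp add: coeff_1)
next
  case (Suc n)
  define p where "p = (\<Prod>i=1..n. [:1, a i:])"
  define b where "b = a (Suc n)"
  have eq: "(\<Prod>i=1..Suc n. [:1, a i:]) = [:1, b:] * p"
    by (simp add: p_def b_def mult.commute)
  have b: "b \<ge> 1" using Suc.prems by (simp add: b_def)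
  define x y z where "x = coeff p 1" and "y = coeff p 2" and "z = coeff p 3"
  have IH: "coeff p 0 = 1" "x \<ge> 0" "y \<le> x\<^sup>2" "y + z \<le> x * y" "(x + 1) * z \<le> y\<^sup>2"
    using Suc unfolding p_def x_def y_def z_def by auto
  have c: "coeff ([:1, b:] * p) 0 = 1" "coeff ([:1, b:] * p) 1 = x + b"
    "coeff ([:1, b:] * p) 2 = y + b * x" "coeff ([:1, b:] * p) 3 = z + b * y"
    using IH(1) by (simp_all add: x_def y_def z_def eval_nat_numeral)
  \<comment> \<open>Splitting \<open>b^2 * x\<close> into \<open>b * x + b * (b - 1) * x\<close> is
    where \<open>b >= 1\<close> enters.\<close>
  have "0 \<le> b * x" "0 \<le> b * x\<^sup>2" "0 \<le> (b * (b - 1)) * x" "0 \<le> b\<^sup>2"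
    using b IH(2) by simp_all
  moreover have "(x + b)\<^sup>2 = x\<^sup>2 + 2 * (b * x) + b\<^sup>2"
    "(x + b) * (y + b * x) = x * y + b * y + b * x + b * x\<^sup>2 + (b * (b - 1)) * x"
    by (simp_all add: power2_eq_square algebra_simps)
  ultimately have "y + b * x \<le> (x + b)\<^sup>2"
    "(y + b * x) + (z + b * y) \<le> (x + b) * (y + b * x)"
    using IH by linarith+
  moreover have "(x + b + 1) * (z + b * y) \<le> (y + b * x)\<^sup>2"
  proof -
    \<comment> \<open>As a polynomial in \<open>b\<close>, the difference has the slacks of the
      three inductive inequalities as its coefficients.\<close>
    have "(y + b * x)\<^sup>2 - (x + b + 1) * (z + b * y) =
        (y\<^sup>2 - (x + 1) * z) + b * (x * y - y - z) + b\<^sup>2 * (x\<^sup>2 - y)"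
      by (simp add: power2_eq_square algebra_simps)
    also have "\<dots> \<ge> 0" using IH b by simp
    finally show ?thesis by simp
  qed
  ultimately show ?case unfolding eq c using b IH(2) by simp
qed

text \<open>The extra \<open>x\<close> raises only the coefficient at 1. For \<open>k = 1\<close>
  this enlarges the square, for \<open>k >= 3\<close> nothing changes, and for \<open>k = 2\<close>
  it enlarges the left side, as allowed for by the sharper inequality on the coefficients 1, 2,
  3.\<close>

lemma prod_linear_plus_x_log_concave:
  fixes a :: "nat \<Rightarrow> real"
  assumes a: "\<And>i. i \<in> {1..n} \<Longrightarrow> a i \<ge> 1" and k: "k \<ge> 1"
  defines "p \<equiv> (\<Prod>i=1..n. [:1, a i:]) + monom 1 1"
  shows "coeff p (k - 1) * coeff p (k + 1) \<le> (coeff p k)\<^sup>2"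
proof -
  define q where "q = (\<Prod>i=1..n. [:1, a i:])"
  have "a i \<ge> 0" if "i \<in> {1..n}" for i using a[OF that] by simp
  from prod_linear_log_concave[of n a, OF this]
  have lc: "coeff q m * coeff q (m + 2) \<le> (coeff q (m + 1))\<^sup>2" for m
    unfolding q_def power2_eq_square by blast
  have ineqs: "coeff q 0 = 1" "coeff q 1 \<ge> 0" "(coeff q 1 + 1) * coeff q 3 \<le> (coeff q 2)\<^sup>2"
    using prod_linear_coeff_ineqs[of n a] a unfolding q_def by auto
  have p: "coeff p m = coeff q m + (if m = 1 then 1 else 0)" for m
    by (auto simp: p_def q_def)
  consider "k = 1" | "k = 2" | "k \<ge> 3" using k by linarith
  then show ?thesis
  proof cases
    case 1
    then show ?thesis using lc[of 0] ineqs by (simp add: p power2_eq_square algebra_simps)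
  next
    case 2
    then show ?thesis using ineqs by (simp add: p)
  next
    case 3
    then obtain m where "k = m + 3" by (metis add.commute le_Suc_ex)
    then show ?thesis using lc[of "m + 2"] by (simp add: p eval_nat_numeral)
  qed
qed

section \<open>From independence polynomials to the sequences\<close>

theorem theorem1p1:
  fixes n :: nat and s :: "nat \<Rightarrow> nat"
  assumes "n \<ge> 1" and "\<forall>i\<in>{1..n}. s i \<ge> 2"
  shows "(\<forall>H :: 'a hypergraph. linear_hyperpath n s H \<longrightarrow>
            real_rooted_seq (card (verts H)) (\<lambda>k. real (indep_count H k))) \<and>
         (\<forall>H :: 'a hypergraph. linear_hyperstar n s H \<longrightarrow>
            log_concave_seq (card (verts H)) (\<lambda>k. real (indep_count H k)))"
proof (intro conjI allI impI)
  fix H :: "'a hypergraph"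
  assume path: "linear_hyperpath n s H"
  then have fin: "finite (verts H)" unfolding linear_hyperpath_def by auto
  have "(\<Sum>k\<le>card (verts H). monom (complex_of_real (real (indep_count H k))) k) =
      indep_poly H (verts H)"
  proof (rule poly_eqI)
    fix m
    have "indep_count H m = 0" if "\<not> m \<le> card (verts H)"
      using indep_count_eq_0[OF fin] that by simp
    then show "coeff (\<Sum>k\<le>card (verts H). monom (complex_of_real (real (indep_count H k))) k) m =
        coeff (indep_poly H (verts H)) m"
      by (auto simp: coeff_sum coeff_indep_poly[OF fin])
  qed
  then show "real_rooted_seq (card (verts H)) (\<lambda>k. real (indep_count H k))"
    unfolding real_rooted_seq_def using hyperpath_indep_poly_nonzero[OF path assms(1)] by auto
next
  fix H :: "'a hypergraph"
  assume star: "linear_hyperstar n s H"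
  then have fin: "finite (verts H)" unfolding linear_hyperstar_def by auto
  have count: "real (indep_count H k) =
      coeff ((\<Prod>i=1..n. [:1, real (s i - 1):]) + monom 1 1) k" for k
    using coeff_indep_poly[OF fin, of k, where ?'b = real]
    by (simp only: hyperstar_indep_poly[OF star assms(1)])
  have "real (s i - 1) \<ge> 1" if "i \<in> {1..n}" for i using assms(2) that by fastforce
  then show "log_concave_seq (card (verts H)) (\<lambda>k. real (indep_count H k))"
    unfolding log_concave_seq_def count
    using prod_linear_plus_x_log_concave[of n "\<lambda>i. real (s i - 1)"] by blast
qed

end
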